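(* Let $P,Q$ be integers. If $n\in S$ and $m$ is a positive integer all of whose prime factors divide $u_n\Delta$, then $nm\in S$.
   Context: For integers $P,Q$, put $\Delta=P^2-4Q$. The Lucas sequence of the first kind $(u_n)_{n\ge0}$ is given by $u_0=0$, $u_1=1$, $u_{n+2}=Pu_{n+1}-Qu_n$ for $n\ge0$. Let $S=S(P,Q)$ be the set of all integers $n\ge1$ such that $n$ divides $u_n$ (every positive integer divides $0$). *)

theory Defs
  imports "HOL-Computational_Algebra.Primes"
begin

fun lucas_u :: "int \<Rightarrow> int \<Rightarrow> nat \<Rightarrow> int" where
  "lucas_u P Q 0 = 0"
| "lucas_u P Q (Suc 0) = 1"
| "lucas_u P Q (Suc (Suc n)) = P * lucas_u P Q (Suc n) - Q * lucas_u P Q n"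

definition lucas_discr :: "int \<Rightarrow> int \<Rightarrow> int" where
  "lucas_discr P Q = P\<^sup>2 - 4 * Q"

definition lucas_S :: "int \<Rightarrow> int \<Rightarrow> nat set" where
  "lucas_S P Q = {n. 1 \<le> n \<and> int n dvd lucas_u P Q n}"

end

theory Submission
  imports Defs "HOL-Number_Theory.Cong"
begin

text \<open>Adding the prime factors of \<open>m\<close> one at a time, it suffices to treat a prime \<open>p\<close> dividing
  \<open>u\<^sub>n \<Delta>\<close>. If \<open>p\<close> divides \<open>u\<^sub>n\<close>, the congruence
  \<open>u\<^sub>k\<^sub>n \<equiv> k u\<^sub>n u\<^sub>n\<^sub>+\<^sub>1^(k - 1)\<close> modulo \<open>u\<^sub>n^2\<close> with \<open>k = p\<close> shows that \<open>p u\<^sub>n\<close> divides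
  \<open>u\<^sub>p\<^sub>n\<close>. Otherwise \<open>p\<close> is prime to \<open>n\<close> and divides \<open>\<Delta>\<close>; then the characteristic polynomial has a
  double root \<open>P/2\<close> modulo \<open>p\<close>, so \<open>p\<close> divides \<open>u\<^sub>p\<close>, and both \<open>n\<close> and \<open>p\<close> divide \<open>u\<^sub>p\<^sub>n\<close>.\<close>

text \<open>Induction on \<open>a\<close> with \<open>b\<close> free: the recurrence moves one unit
  of index from one factor to the other.\<close>

lemma lucas_u_add_Suc:
  "lucas_u P Q (Suc (a + b)) = lucas_u P Q (Suc a) * lucas_u P Q (Suc b) - Q * lucas_u P Q a * lucas_u P Q b"
proof (induction a arbitrary: b)
  case (Suc a)
  show ?case using Suc[of "Suc b"] by (simp add: algebra_simps)
qed simp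

text \<open>Replacing \<open>Q\<close> times the term before index \<open>a\<close> by means of the
  recurrence removes any index \<open>a - 1\<close>.\<close>

lemma lucas_u_add:
  "lucas_u P Q (a + b) = lucas_u P Q a * lucas_u P Q (Suc b) + lucas_u P Q (Suc a) * lucas_u P Q b
     - P * lucas_u P Q a * lucas_u P Q b"
  by (cases a) (simp_all add: lucas_u_add_Suc algebra_simps)

lemma lucas_u_dvd_mult: "lucas_u P Q n dvd lucas_u P Q (k * n)"
proof (induction k)
  case (Suc k)
  then have "lucas_u P Q n dvd lucas_u P Q (k * n + n)"
    unfolding lucas_u_add by (intro dvd_add dvd_diff) simp_all
  then show ?case by (simp add: add.commute)
qed simp

lemma lucas_u_Suc_mult_cong:
  "[lucas_u P Q (Suc (k * n)) = lucas_u P Q (Suc n) ^ k] (mod lucas_u P Q n)"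
proof (induction k)
  case (Suc k)
  have "[lucas_u P Q (Suc (k * n + n)) = lucas_u P Q (Suc (k * n)) * lucas_u P Q (Suc n)] (mod lucas_u P Q n)"
    unfolding lucas_u_add_Suc by (simp add: cong_iff_dvd_diff)
  also have "[lucas_u P Q (Suc (k * n)) * lucas_u P Q (Suc n) = lucas_u P Q (Suc n) ^ k * lucas_u P Q (Suc n)]
      (mod lucas_u P Q n)"
    by (rule cong_scalar_right[OF Suc])
  finally show ?case by (simp add: ac_simps)
qed simp

text \<open>In the addition formula, \<open>u\<close> at \<open>Suc ?a\<close> is multiplied by
  \<open>?u\<close>, so knowing it modulo \<open>?u\<close> suffices; the term with factor
  \<open>P\<close> vanishes modulo the square. Using \<open>Suc k\<close> keeps the exponent free of
  subtraction.\<close>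

lemma lucas_u_Suc_times_cong:
  "[lucas_u P Q (Suc k * n) = int (Suc k) * lucas_u P Q n * lucas_u P Q (Suc n) ^ k] (mod (lucas_u P Q n)\<^sup>2)"
proof (induction k)
  case (Suc k)
  let ?u = "lucas_u P Q n" and ?v = "lucas_u P Q (Suc n)" and ?a = "Suc k * n"
  obtain c where c: "lucas_u P Q ?a = ?u * c"
    using lucas_u_dvd_mult by blast
  obtain d where d: "lucas_u P Q (Suc ?a) - ?v ^ Suc k = ?u * d"
    using lucas_u_Suc_mult_cong[of P Q "Suc k" n] unfolding cong_iff_dvd_diff by (rule dvdE)
  obtain e where e: "lucas_u P Q ?a - int (Suc k) * ?u * ?v ^ k = ?u\<^sup>2 * e"
    using Suc unfolding cong_iff_dvd_diff by (rule dvdE)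
  have "lucas_u P Q (Suc (Suc k) * n) = lucas_u P Q (?a + n)"
    by (simp add: ac_simps)
  also have "\<dots> = lucas_u P Q ?a * ?v + lucas_u P Q (Suc ?a) * ?u - P * lucas_u P Q ?a * ?u"
    by (rule lucas_u_add)
  also have "\<dots> = (int (Suc k) * ?u * ?v ^ k + ?u\<^sup>2 * e) * ?v + (?v ^ Suc k + ?u * d) * ?u - P * (?u * c) * ?u"
    using c d e by (simp add: algebra_simps del: mult_Suc lucas_u.simps)
  also have "\<dots> = int (Suc (Suc k)) * ?u * ?v ^ Suc k + ?u\<^sup>2 * (e * ?v + d - P * c)"
    by (simp add: algebra_simps power2_eq_square)
  finally show ?case by (simp add: cong_iff_dvd_diff del: mult_Suc)
qed simp

lemma prime_times_lucas_u_dvd: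
  assumes "prime p" "int p dvd lucas_u P Q n"
  shows "int p * lucas_u P Q n dvd lucas_u P Q (p * n)"
proof -
  obtain k where p: "p = Suc k" using prime_gt_0_nat[OF assms(1)] gr0_implies_Suc by blast
  let ?r = "int p * lucas_u P Q n * lucas_u P Q (Suc n) ^ k"
  \<comment> \<open>Since \<open>p\<close> divides the Lucas term, a congruence modulo its square is
    also one modulo \<open>p\<close> times it.\<close>
  have "int p * lucas_u P Q n dvd (lucas_u P Q n)\<^sup>2"
    unfolding power2_eq_square by (rule mult_dvd_mono[OF assms(2) dvd_refl])
  also have "(lucas_u P Q n)\<^sup>2 dvd lucas_u P Q (p * n) - ?r"
    using lucas_u_Suc_times_cong[of P Q k n] unfolding p cong_iff_dvd_diff .
  finally have "int p * lucas_u P Q n dvd (lucas_u P Q (p * n) - ?r) + ?r"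
    by (rule dvd_add) simp
  then show ?thesis by simp
qed

text \<open>A double root \<open>P/2\<close> gives the terms \<open>(k + 1) * (P/2)^k\<close>; the
  power of 2 clears the denominators.\<close>

lemma two_power_lucas_u_cong:
  "[2 ^ k * lucas_u P Q (Suc k) = int (Suc k) * P ^ k] (mod lucas_discr P Q)"
proof (induction k rule: induct_nat_012)
  case (ge2 k)
  obtain c where c: "2 ^ k * lucas_u P Q (Suc k) - int (Suc k) * P ^ k = lucas_discr P Q * c"
    using ge2(1) unfolding cong_iff_dvd_diff by (rule dvdE)
  obtain d where d: "2 ^ Suc k * lucas_u P Q (Suc (Suc k)) - int (Suc (Suc k)) * P ^ Suc k = lucas_discr P Q * d"
    using ge2(2) unfolding cong_iff_dvd_diff by (rule dvdE)
  \<comment> \<open>Modulo the discriminant, \<open>4 * Q\<close> becomes the square of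
    \<open>P\<close>, and the coefficients combine as
    \<open>2 * (k + 2) - (k + 1) = k + 3\<close>.\<close>
  have Q: "4 * Q = P\<^sup>2 - lucas_discr P Q" by (simp add: lucas_discr_def)
  have "2 ^ Suc (Suc k) * lucas_u P Q (Suc (Suc (Suc k)))
      = 2 * P * (2 ^ Suc k * lucas_u P Q (Suc (Suc k))) - 4 * Q * (2 ^ k * lucas_u P Q (Suc k))"
    by (simp add: algebra_simps)
  also have "\<dots> = 2 * P * (int (Suc (Suc k)) * P ^ Suc k + lucas_discr P Q * d)
      - (P\<^sup>2 - lucas_discr P Q) * (int (Suc k) * P ^ k + lucas_discr P Q * c)"
    using c d unfolding Q by (simp add: diff_eq_eq add.commute del: lucas_u.simps power_Suc)
  also have "\<dots> = int (Suc (Suc (Suc k))) * P ^ Suc (Suc k)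
      + lucas_discr P Q * (2 * P * d - (P\<^sup>2 - lucas_discr P Q) * c + int (Suc k) * P ^ k)"
    by (simp add: algebra_simps power2_eq_square)
  finally show ?case by (simp add: cong_iff_dvd_diff del: lucas_u.simps)
qed simp_all

lemma prime_dvd_lucas_u_self:
  assumes "prime p" "int p dvd lucas_discr P Q"
  shows "int p dvd lucas_u P Q p"
proof (cases "p = 2")
  case True
  \<comment> \<open>The power of 2 cannot be cancelled here, but the term at index 2 is
    \<open>P\<close> itself.\<close>
  then have "even P" using assms(2) by (simp add: lucas_discr_def)
  then show ?thesis by (simp add: True numeral_2_eq_2)
next
  case False
  obtain k where p: "p = Suc k" using prime_gt_0_nat[OF assms(1)] gr0_implies_Suc by blast
  have "[2 ^ k * lucas_u P Q p = int p * P ^ k] (mod int p)"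
    using two_power_lucas_u_cong[of k P Q] assms(2) unfolding p by (rule cong_dvd_modulus)
  then have "int p dvd 2 ^ k * lucas_u P Q p"
    by (simp add: cong_dvd_iff)
  moreover have "\<not> int p dvd 2 ^ k"
  proof
    assume "int p dvd 2 ^ k"
    then have "p dvd 2 ^ k" by (metis of_nat_dvd_iff of_nat_numeral of_nat_power)
    then show False
      using False assms(1) prime_dvd_power primes_dvd_imp_eq two_is_prime_nat by blast
  qed
  ultimately show ?thesis
    using assms(1) prime_dvd_mult_iff[of "int p"] by simp
qed

lemma lucas_S_prime_mult:
  assumes "n \<in> lucas_S P Q" "prime p" "int p dvd lucas_u P Q n * lucas_discr P Q"
  shows "p * n \<in> lucas_S P Q"
proof -
  have n: "n \<ge> 1" "int n dvd lucas_u P Q n" using assms(1) by (auto simp: lucas_S_def)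
  have "int p * int n dvd lucas_u P Q (p * n)"
  proof (cases "int p dvd lucas_u P Q n")
    case True
    have "int p * int n dvd int p * lucas_u P Q n" using n(2) by simp
    also have "\<dots> dvd lucas_u P Q (p * n)" by (rule prime_times_lucas_u_dvd[OF assms(2) True])
    finally show ?thesis .
  next
    case False
    then have "int p dvd lucas_discr P Q"
      using assms(2,3) prime_dvd_mult_iff[of "int p"] by simp
    then have "int p dvd lucas_u P Q (p * n)"
      using prime_dvd_lucas_u_self[OF assms(2)] lucas_u_dvd_mult[of P Q p n]
      by (metis dvd_trans mult.commute)
    moreover have "int n dvd lucas_u P Q (p * n)"
      using n(2) lucas_u_dvd_mult by (rule dvd_trans)
    \<comment> \<open>Otherwise \<open>p\<close> would divide the Lucas term at \<open>n\<close>,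
      which \<open>n\<close> divides.\<close>
    moreover have "\<not> int p dvd int n"
      using False n(2) dvd_trans by blast
    then have "coprime (int p) (int n)"
      using assms(2) by (intro prime_imp_coprime) simp_all
    ultimately show ?thesis by (rule divides_mult)
  qed
  then show ?thesis using n(1) prime_gt_0_nat[OF assms(2)] by (simp add: lucas_S_def)
qed

theorem corollary2:
  fixes P Q :: int and n m :: nat
  assumes "n \<in> lucas_S P Q"
    and "m > 0"
    and "\<And>p :: nat. prime p \<Longrightarrow> p dvd m \<Longrightarrow> int p dvd lucas_u P Q n * lucas_discr P Q"
  shows "n * m \<in> lucas_S P Q"
  using assms
proof (induction m arbitrary: n rule: prime_divisors_induct)
  case (factor p m)
  have "p * n \<in> lucas_S P Q"
    using factor.prems factor.hyps by (intro lucas_S_prime_mult) auto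
  \<comment> \<open>The hypothesis passes from \<open>n\<close> to \<open>p * n\<close> because the
    Lucas term at \<open>n\<close> divides the one at \<open>p * n\<close>.\<close>
  moreover have "int q dvd lucas_u P Q (p * n) * lucas_discr P Q" if "prime q" "q dvd m" for q
    using factor.prems(3)[OF that(1)] that(2) mult_dvd_mono[OF lucas_u_dvd_mult dvd_refl]
    by (meson dvd_mult dvd_trans)
  ultimately have "p * n * m \<in> lucas_S P Q"
    using factor.IH factor.prems(2) by auto
  then show ?case by (simp add: ac_simps)
qed simp_all

end
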